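(* Let $S_{\mathbb{N}}$ be the set of magic labellings of the cube, i.e. the set of $\alpha=(x_1,\dots,x_{12})\in\mathbb{N}^{12}$ for which there is $r\in\mathbb{N}$ with $x_1+x_2+x_9=r$, $x_1+x_3+x_{10}=r$, $x_2+x_4+x_{12}=r$, $x_3+x_4+x_{11}=r$, $x_5+x_6+x_9=r$, $x_5+x_7+x_{10}=r$, $x_6+x_8+x_{12}=r$, $x_7+x_8+x_{11}=r$. Let $e_1,\dots,e_{12}$ be the standard unit vectors of $\mathbb{N}^{12}$ and put $\alpha_1=e_2+e_3+e_5+e_8$, $\alpha_2=e_1+e_4+e_6+e_7$, $\alpha_3=e_1+e_5+e_{11}+e_{12}$, $\alpha_4=e_2+e_6+e_{10}+e_{11}$, $\alpha_5=e_1+e_4+e_5+e_8$, $\alpha_6=e_4+e_8+e_9+e_{10}$, $\alpha_7=e_3+e_7+e_9+e_{12}$, $\alpha_8=e_2+e_3+e_6+e_7$, $\alpha_9=e_9+e_{10}+e_{11}+e_{12}$, and $T=\sum_{i=1}^{12}e_i$. Then every $\alpha\in S_{\mathbb{N}}$ can be written uniquely in one of the following eight types, where $k_1,\dots,k_6\in\mathbb{N}$: (t1) $k_1\alpha_1+k_2\alpha_2+k_3\alpha_3+k_4\alpha_4+k_5\alpha_5+k_6\alpha_6$; (t2) $\alpha_7+k_1\alpha_1+k_2\alpha_2+k_3\alpha_3+k_4\alpha_5+k_5\alpha_6+k_6\alpha_7$; (t31) $\alpha_9+k_1\alpha_2+k_2\alpha_3+k_3\alpha_4+k_4\alpha_6+k_5\alpha_7+k_6\alpha_9$;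 (t32) $(\alpha_1+\alpha_9)+k_1\alpha_1+k_2\alpha_3+k_3\alpha_4+k_4\alpha_6+k_5\alpha_7+k_6\alpha_9$; (t33) $(\alpha_6+\alpha_8)+k_1\alpha_1+k_2\alpha_2+k_3\alpha_4+k_4\alpha_6+k_5\alpha_7+k_6\alpha_8$; (t34) $\alpha_8+k_1\alpha_1+k_2\alpha_2+k_3\alpha_3+k_4\alpha_4+k_5\alpha_7+k_6\alpha_8$; (t351) $(\alpha_4+\alpha_7)+k_1\alpha_1+k_2\alpha_2+k_3\alpha_3+k_4\alpha_4+k_5\alpha_6+k_6\alpha_7$; (t352) $T+k_1\alpha_1+k_2\alpha_2+k_3\alpha_3+k_4\alpha_4+k_5\alpha_6+k_6\alpha_7$. That is, for each $\alpha\in S_{\mathbb{N}}$ there is exactly one type and exactly one tuple $(k_1,\dots,k_6)\in\mathbb{N}^6$ for which $\alpha$ equals the corresponding expression.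
   Context: The cube graph has 8 vertices and 12 edges numbered $1,\dots,12$; the eight vertices are incident to the edge sets $\{1,2,9\},\{1,3,10\},\{2,4,12\},\{3,4,11\},\{5,6,9\},\{5,7,10\},\{6,8,12\},\{7,8,11\}$. A labelling assigns $x_i\in\mathbb{N}$ to edge $i$; it is magic with magic sum $r$ if for every vertex the sum of the labels of the three incident edges equals $r$. $\mathbb{N}=\{0,1,2,\dots\}$. *)

theory Defs
  imports "HOL-Analysis.Analysis"
begin

(* The coordinates x_1, ..., x_12 of a labelling are x $ 1, ..., x $ 12.  In the numeral type 12 the
   index 12 is the residue 0, so 1, ..., 12 are precisely its twelve distinct elements (and likewise
   1, ..., 6 in the numeral type 6). *)

definition magic_with_sum :: "nat ^ 12 \<Rightarrow> nat \<Rightarrow> bool" where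
  "magic_with_sum x r \<longleftrightarrow>
    x $ 1 + x $ 2 + x $ 9 = r \<and>
    x $ 1 + x $ 3 + x $ 10 = r \<and>
    x $ 2 + x $ 4 + x $ 12 = r \<and>
    x $ 3 + x $ 4 + x $ 11 = r \<and>
    x $ 5 + x $ 6 + x $ 9 = r \<and>
    x $ 5 + x $ 7 + x $ 10 = r \<and>
    x $ 6 + x $ 8 + x $ 12 = r \<and>
    x $ 7 + x $ 8 + x $ 11 = r"

definition magic_labellings :: "(nat ^ 12) set" where
  "magic_labellings = {x. \<exists>r. magic_with_sum x r}"

definition e :: "12 \<Rightarrow> nat ^ 12" where
  "e i = axis i 1"

definition \<alpha>\<^sub>1 :: "nat ^ 12" where "\<alpha>\<^sub>1 = e 2 + e 3 + e 5 + e 8"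
definition \<alpha>\<^sub>2 :: "nat ^ 12" where "\<alpha>\<^sub>2 = e 1 + e 4 + e 6 + e 7"
definition \<alpha>\<^sub>3 :: "nat ^ 12" where "\<alpha>\<^sub>3 = e 1 + e 5 + e 11 + e 12"
definition \<alpha>\<^sub>4 :: "nat ^ 12" where "\<alpha>\<^sub>4 = e 2 + e 6 + e 10 + e 11"
definition \<alpha>\<^sub>5 :: "nat ^ 12" where "\<alpha>\<^sub>5 = e 1 + e 4 + e 5 + e 8"
definition \<alpha>\<^sub>6 :: "nat ^ 12" where "\<alpha>\<^sub>6 = e 4 + e 8 + e 9 + e 10"
definition \<alpha>\<^sub>7 :: "nat ^ 12" where "\<alpha>\<^sub>7 = e 3 + e 7 + e 9 + e 12"
definition \<alpha>\<^sub>8 :: "nat ^ 12" where "\<alpha>\<^sub>8 = e 2 + e 3 + e 6 + e 7"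
definition \<alpha>\<^sub>9 :: "nat ^ 12" where "\<alpha>\<^sub>9 = e 9 + e 10 + e 11 + e 12"
definition T :: "nat ^ 12" where "T = (\<Sum>i\<in>UNIV. e i)"

datatype labelling_type =
  t1 | t2 | t31 | t32 | t33 | t34 | t351 | t352

fun labelling_of :: "labelling_type \<Rightarrow> nat ^ 6 \<Rightarrow> nat ^ 12" where
  "labelling_of t1 k = k $ 1 *s \<alpha>\<^sub>1 + k $ 2 *s \<alpha>\<^sub>2 + k $ 3 *s \<alpha>\<^sub>3 + k $ 4 *s \<alpha>\<^sub>4 + k $ 5 *s \<alpha>\<^sub>5 + k $ 6 *s \<alpha>\<^sub>6"
| "labelling_of t2 k = \<alpha>\<^sub>7 + k $ 1 *s \<alpha>\<^sub>1 + k $ 2 *s \<alpha>\<^sub>2 + k $ 3 *s \<alpha>\<^sub>3 + k $ 4 *s \<alpha>\<^sub>5 + k $ 5 *s \<alpha>\<^sub>6 + k $ 6 *s \<alpha>\<^sub>7"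
| "labelling_of t31 k = \<alpha>\<^sub>9 + k $ 1 *s \<alpha>\<^sub>2 + k $ 2 *s \<alpha>\<^sub>3 + k $ 3 *s \<alpha>\<^sub>4 + k $ 4 *s \<alpha>\<^sub>6 + k $ 5 *s \<alpha>\<^sub>7 + k $ 6 *s \<alpha>\<^sub>9"
| "labelling_of t32 k = (\<alpha>\<^sub>1 + \<alpha>\<^sub>9) + k $ 1 *s \<alpha>\<^sub>1 + k $ 2 *s \<alpha>\<^sub>3 + k $ 3 *s \<alpha>\<^sub>4 + k $ 4 *s \<alpha>\<^sub>6 + k $ 5 *s \<alpha>\<^sub>7 + k $ 6 *s \<alpha>\<^sub>9"
| "labelling_of t33 k = (\<alpha>\<^sub>6 + \<alpha>\<^sub>8) + k $ 1 *s \<alpha>\<^sub>1 + k $ 2 *s \<alpha>\<^sub>2 + k $ 3 *s \<alpha>\<^sub>4 + k $ 4 *s \<alpha>\<^sub>6 + k $ 5 *s \<alpha>\<^sub>7 + k $ 6 *s \<alpha>\<^sub>8"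
| "labelling_of t34 k = \<alpha>\<^sub>8 + k $ 1 *s \<alpha>\<^sub>1 + k $ 2 *s \<alpha>\<^sub>2 + k $ 3 *s \<alpha>\<^sub>3 + k $ 4 *s \<alpha>\<^sub>4 + k $ 5 *s \<alpha>\<^sub>7 + k $ 6 *s \<alpha>\<^sub>8"
| "labelling_of t351 k = (\<alpha>\<^sub>4 + \<alpha>\<^sub>7) + k $ 1 *s \<alpha>\<^sub>1 + k $ 2 *s \<alpha>\<^sub>2 + k $ 3 *s \<alpha>\<^sub>3 + k $ 4 *s \<alpha>\<^sub>4 + k $ 5 *s \<alpha>\<^sub>6 + k $ 6 *s \<alpha>\<^sub>7"
| "labelling_of t352 k = T + k $ 1 *s \<alpha>\<^sub>1 + k $ 2 *s \<alpha>\<^sub>2 + k $ 3 *s \<alpha>\<^sub>3 + k $ 4 *s \<alpha>\<^sub>4 + k $ 5 *s \<alpha>\<^sub>6 + k $ 6 *s \<alpha>\<^sub>7"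

end

theory Submission
  imports Defs
begin

text \<open>
  On labellings of a given type the coefficients are explicit linear functions of the labels, and
  their nonnegativity cuts out a region of the cone of magic labellings. The six generators of the
  types t351 and t352 span a sublattice of index 2, parity tells these two types apart, and their
  common region is given by triangle inequalities. A triangle inequality can fail in three mutually
  exclusive ways; each is shared by two of the other types, which are told apart by comparing two
  labels. So the eight regions partition the magic labellings.
\<close>

lemma forall_6: "(\<forall>i::6. P i) \<longleftrightarrow> P 1 \<and> P 2 \<and> P 3 \<and> P 4 \<and> P 5 \<and> P 6"
proof -
  have "i \<in> {1, 2, 3, 4, 5, 6}" for i :: 6
  proof (cases i rule: bit0_cases)
    case (of_int z)
    \<comment> \<open>The representative 0 is the index 6.\<close>
    then have "z \<in> {0, 1, 2, 3, 4, 5}"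
      by auto
    with of_int show ?thesis
      by auto
  qed
  then show ?thesis
    by (metis empty_iff insert_iff)
qed

lemma forall_12:
  "(\<forall>i::12. P i) \<longleftrightarrow>
    P 1 \<and> P 2 \<and> P 3 \<and> P 4 \<and> P 5 \<and> P 6 \<and> P 7 \<and> P 8 \<and> P 9 \<and> P 10 \<and> P 11 \<and> P 12"
proof -
  have "i \<in> {1, 2, 3, 4, 5, 6, 7, 8, 9, 10, 11, 12}" for i :: 12
  proof (cases i rule: bit0_cases)
    case (of_int z)
    then have "z \<in> {0, 1, 2, 3, 4, 5, 6, 7, 8, 9, 10, 11}"
      by simp presburger
    with of_int show ?thesis
      by auto
  qed
  then show ?thesis
    by (metis empty_iff insert_iff)
qed

lemma vec_6_eq_iff:
  "k = k' \<longleftrightarrow> k $ 1 = k' $ 1 \<and> k $ 2 = k' $ 2 \<and> k $ 3 = k' $ 3 \<and>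
    k $ 4 = k' $ 4 \<and> k $ 5 = k' $ 5 \<and> k $ 6 = k' $ 6" for k k' :: "'a ^ 6"
  by (simp add: vec_eq_iff forall_6)

definition vec_6 :: "'a \<Rightarrow> 'a \<Rightarrow> 'a \<Rightarrow> 'a \<Rightarrow> 'a \<Rightarrow> 'a \<Rightarrow> 'a ^ 6" where
  "vec_6 a b c d f g = (\<chi> i. if i = 1 then a else if i = 2 then b else if i = 3 then c
        else if i = 4 then d else if i = 5 then f else g)"

lemma vec_6_nth [simp]:
  "vec_6 a b c d f g $ 1 = a" "vec_6 a b c d f g $ 2 = b" "vec_6 a b c d f g $ 3 = c"
  "vec_6 a b c d f g $ 4 = d" "vec_6 a b c d f g $ 5 = f" "vec_6 a b c d f g $ 6 = g"
  by (simp_all add: vec_6_def)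

lemma e_nth: "e i $ j = (if i = j then 1 else 0)"
  by (simp add: e_def axis_def)

lemma T_nth: "T $ j = 1"
  by (simp add: T_def e_nth)

lemmas labelling_nth = vec_eq_iff forall_12 \<alpha>\<^sub>1_def \<alpha>\<^sub>2_def \<alpha>\<^sub>3_def \<alpha>\<^sub>4_def \<alpha>\<^sub>5_def
  \<alpha>\<^sub>6_def \<alpha>\<^sub>7_def \<alpha>\<^sub>8_def \<alpha>\<^sub>9_def T_nth e_nth

lemma labelling_of_t1_iff:
  "x = labelling_of t1 k \<longleftrightarrow>
    x $ 1 = k $ 2 + k $ 3 + k $ 5 \<and> x $ 2 = k $ 1 + k $ 4 \<and> x $ 3 = k $ 1 \<and>
    x $ 4 = k $ 2 + k $ 5 + k $ 6 \<and> x $ 5 = k $ 1 + k $ 3 + k $ 5 \<and> x $ 6 = k $ 2 + k $ 4 \<and>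
    x $ 7 = k $ 2 \<and> x $ 8 = k $ 1 + k $ 5 + k $ 6 \<and> x $ 9 = k $ 6 \<and>
    x $ 10 = k $ 4 + k $ 6 \<and> x $ 11 = k $ 3 + k $ 4 \<and> x $ 12 = k $ 3"
  by (simp add: labelling_nth)

lemma labelling_of_t2_iff:
  "x = labelling_of t2 k \<longleftrightarrow>
    x $ 1 = k $ 2 + k $ 3 + k $ 4 \<and> x $ 2 = k $ 1 \<and> x $ 3 = k $ 1 + k $ 6 + 1 \<and>
    x $ 4 = k $ 2 + k $ 4 + k $ 5 \<and> x $ 5 = k $ 1 + k $ 3 + k $ 4 \<and> x $ 6 = k $ 2 \<and>
    x $ 7 = k $ 2 + k $ 6 + 1 \<and> x $ 8 = k $ 1 + k $ 4 + k $ 5 \<and> x $ 9 = k $ 5 + k $ 6 + 1 \<and>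
    x $ 10 = k $ 5 \<and> x $ 11 = k $ 3 \<and> x $ 12 = k $ 3 + k $ 6 + 1"
  by (simp add: labelling_nth)

lemma labelling_of_t31_iff:
  "x = labelling_of t31 k \<longleftrightarrow>
    x $ 1 = k $ 1 + k $ 2 \<and> x $ 2 = k $ 3 \<and> x $ 3 = k $ 5 \<and>
    x $ 4 = k $ 1 + k $ 4 \<and> x $ 5 = k $ 2 \<and> x $ 6 = k $ 1 + k $ 3 \<and>
    x $ 7 = k $ 1 + k $ 5 \<and> x $ 8 = k $ 4 \<and> x $ 9 = k $ 4 + k $ 5 + k $ 6 + 1 \<and>
    x $ 10 = k $ 3 + k $ 4 + k $ 6 + 1 \<and> x $ 11 = k $ 2 + k $ 3 + k $ 6 + 1 \<and> x $ 12 = k $ 2 + k $ 5 + k $ 6 + 1"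
  by (simp add: labelling_nth)

lemma labelling_of_t32_iff:
  "x = labelling_of t32 k \<longleftrightarrow>
    x $ 1 = k $ 2 \<and> x $ 2 = k $ 1 + k $ 3 + 1 \<and> x $ 3 = k $ 1 + k $ 5 + 1 \<and>
    x $ 4 = k $ 4 \<and> x $ 5 = k $ 1 + k $ 2 + 1 \<and> x $ 6 = k $ 3 \<and>
    x $ 7 = k $ 5 \<and> x $ 8 = k $ 1 + k $ 4 + 1 \<and> x $ 9 = k $ 4 + k $ 5 + k $ 6 + 1 \<and>
    x $ 10 = k $ 3 + k $ 4 + k $ 6 + 1 \<and> x $ 11 = k $ 2 + k $ 3 + k $ 6 + 1 \<and> x $ 12 = k $ 2 + k $ 5 + k $ 6 + 1"
  by (simp add: labelling_nth)

lemma labelling_of_t33_iff: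
  "x = labelling_of t33 k \<longleftrightarrow>
    x $ 1 = k $ 2 \<and> x $ 2 = k $ 1 + k $ 3 + k $ 6 + 1 \<and> x $ 3 = k $ 1 + k $ 5 + k $ 6 + 1 \<and>
    x $ 4 = k $ 2 + k $ 4 + 1 \<and> x $ 5 = k $ 1 \<and> x $ 6 = k $ 2 + k $ 3 + k $ 6 + 1 \<and>
    x $ 7 = k $ 2 + k $ 5 + k $ 6 + 1 \<and> x $ 8 = k $ 1 + k $ 4 + 1 \<and> x $ 9 = k $ 4 + k $ 5 + 1 \<and>
    x $ 10 = k $ 3 + k $ 4 + 1 \<and> x $ 11 = k $ 3 \<and> x $ 12 = k $ 5"
  by (simp add: labelling_nth)

lemma labelling_of_t34_iff:
  "x = labelling_of t34 k \<longleftrightarrow>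
    x $ 1 = k $ 2 + k $ 3 \<and> x $ 2 = k $ 1 + k $ 4 + k $ 6 + 1 \<and> x $ 3 = k $ 1 + k $ 5 + k $ 6 + 1 \<and>
    x $ 4 = k $ 2 \<and> x $ 5 = k $ 1 + k $ 3 \<and> x $ 6 = k $ 2 + k $ 4 + k $ 6 + 1 \<and>
    x $ 7 = k $ 2 + k $ 5 + k $ 6 + 1 \<and> x $ 8 = k $ 1 \<and> x $ 9 = k $ 5 \<and>
    x $ 10 = k $ 4 \<and> x $ 11 = k $ 3 + k $ 4 \<and> x $ 12 = k $ 3 + k $ 5"
  by (simp add: labelling_nth)

lemma labelling_of_t351_iff:
  "x = labelling_of t351 k \<longleftrightarrow>
    x $ 1 = k $ 2 + k $ 3 \<and> x $ 2 = k $ 1 + k $ 4 + 1 \<and> x $ 3 = k $ 1 + k $ 6 + 1 \<and>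
    x $ 4 = k $ 2 + k $ 5 \<and> x $ 5 = k $ 1 + k $ 3 \<and> x $ 6 = k $ 2 + k $ 4 + 1 \<and>
    x $ 7 = k $ 2 + k $ 6 + 1 \<and> x $ 8 = k $ 1 + k $ 5 \<and> x $ 9 = k $ 5 + k $ 6 + 1 \<and>
    x $ 10 = k $ 4 + k $ 5 + 1 \<and> x $ 11 = k $ 3 + k $ 4 + 1 \<and> x $ 12 = k $ 3 + k $ 6 + 1"
  by (simp add: labelling_nth)

lemma labelling_of_t352_iff:
  "x = labelling_of t352 k \<longleftrightarrow>
    x $ 1 = k $ 2 + k $ 3 + 1 \<and> x $ 2 = k $ 1 + k $ 4 + 1 \<and> x $ 3 = k $ 1 + k $ 6 + 1 \<and>
    x $ 4 = k $ 2 + k $ 5 + 1 \<and> x $ 5 = k $ 1 + k $ 3 + 1 \<and> x $ 6 = k $ 2 + k $ 4 + 1 \<and>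
    x $ 7 = k $ 2 + k $ 6 + 1 \<and> x $ 8 = k $ 1 + k $ 5 + 1 \<and> x $ 9 = k $ 5 + k $ 6 + 1 \<and>
    x $ 10 = k $ 4 + k $ 5 + 1 \<and> x $ 11 = k $ 3 + k $ 4 + 1 \<and> x $ 12 = k $ 3 + k $ 6 + 1"
  by (simp add: labelling_nth)

lemmas labelling_of_iff = labelling_of_t1_iff labelling_of_t2_iff labelling_of_t31_iff
  labelling_of_t32_iff labelling_of_t33_iff labelling_of_t34_iff labelling_of_t351_iff
  labelling_of_t352_iff

text \<open>
  In the last two types, the labels 3, 5, 12 are up to the offset the pairwise sums of the
  coefficients of \<open>\<alpha>\<^sub>1\<close>, \<open>\<alpha>\<^sub>3\<close>, \<open>\<alpha>\<^sub>7\<close>, and the labels 4, 6, 10 those of \<open>\<alpha>\<^sub>2\<close>, \<open>\<alpha>\<^sub>4\<close>, \<open>\<alpha>\<^sub>6\<close>. Two of the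
  triangle inequalities are strict because of the offset \<open>\<alpha>\<^sub>4 + \<alpha>\<^sub>7\<close> of t351; for t352 the sums
  are odd and all six are automatically strict.
\<close>
definition triangles :: "nat ^ 12 \<Rightarrow> bool" where
  "triangles x \<longleftrightarrow>
    x $ 12 \<le> x $ 3 + x $ 5 \<and> x $ 3 \<le> x $ 5 + x $ 12 \<and> x $ 5 < x $ 3 + x $ 12 \<and>
    x $ 10 \<le> x $ 4 + x $ 6 \<and> x $ 6 \<le> x $ 4 + x $ 10 \<and> x $ 4 < x $ 6 + x $ 10"

text \<open>For each of the first six types, four coefficients are themselves labels; the two
  conditions say that the other two, which are differences, are nonnegative.\<close>

fun region :: "labelling_type \<Rightarrow> nat ^ 12 \<Rightarrow> bool" where
  "region t1 x \<longleftrightarrow> x $ 3 \<le> x $ 2 \<and> x $ 3 + x $ 12 \<le> x $ 5"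
| "region t2 x \<longleftrightarrow> x $ 2 < x $ 3 \<and> x $ 6 + x $ 10 \<le> x $ 4"
| "region t31 x \<longleftrightarrow> x $ 5 \<le> x $ 1 \<and> x $ 3 + x $ 5 < x $ 12"
| "region t32 x \<longleftrightarrow> x $ 1 < x $ 5 \<and> x $ 4 + x $ 6 < x $ 10"
| "region t33 x \<longleftrightarrow> x $ 1 < x $ 4 \<and> x $ 5 + x $ 12 < x $ 3"
| "region t34 x \<longleftrightarrow> x $ 4 \<le> x $ 1 \<and> x $ 4 + x $ 10 < x $ 6"
| "region t351 x \<longleftrightarrow> triangles x \<and> even (x $ 3 + x $ 5 + x $ 12)"
| "region t352 x \<longleftrightarrow> triangles x \<and> odd (x $ 3 + x $ 5 + x $ 12)"

text \<open>
  Division rounds down, which lets one formula serve both parities. The two strict differences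
  exceed twice the coefficient by 2 for t351 and by 1 for t352, hence the \<open>- 1\<close>.
\<close>
definition triangle_coefficients :: "nat ^ 12 \<Rightarrow> nat ^ 6" where
  "triangle_coefficients x = vec_6
    ((x $ 3 + x $ 5 - x $ 12) div 2) ((x $ 4 + x $ 6 - x $ 10) div 2)
    ((x $ 5 + x $ 12 - x $ 3) div 2) ((x $ 6 + x $ 10 - x $ 4 - 1) div 2)
    ((x $ 4 + x $ 10 - x $ 6) div 2) ((x $ 3 + x $ 12 - x $ 5 - 1) div 2)"

text \<open>On the region of the type every subtraction is exact, so truncation at 0 does not matter
  there.\<close>

fun coefficients :: "labelling_type \<Rightarrow> nat ^ 12 \<Rightarrow> nat ^ 6" where
  "coefficients t1 x = vec_6 (x $ 3) (x $ 7) (x $ 12) (x $ 2 - x $ 3) (x $ 5 - (x $ 3 + x $ 12)) (x $ 9)"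
| "coefficients t2 x =
    vec_6 (x $ 2) (x $ 6) (x $ 11) (x $ 4 - (x $ 6 + x $ 10)) (x $ 10) (x $ 3 - x $ 2 - 1)"
| "coefficients t31 x =
    vec_6 (x $ 1 - x $ 5) (x $ 5) (x $ 2) (x $ 8) (x $ 3) (x $ 12 - (x $ 3 + x $ 5) - 1)"
| "coefficients t32 x =
    vec_6 (x $ 5 - x $ 1 - 1) (x $ 1) (x $ 6) (x $ 4) (x $ 7) (x $ 10 - (x $ 4 + x $ 6) - 1)"
| "coefficients t33 x =
    vec_6 (x $ 5) (x $ 1) (x $ 11) (x $ 4 - x $ 1 - 1) (x $ 12) (x $ 3 - (x $ 5 + x $ 12) - 1)"
| "coefficients t34 x =
    vec_6 (x $ 8) (x $ 4) (x $ 1 - x $ 4) (x $ 10) (x $ 9) (x $ 6 - (x $ 4 + x $ 10) - 1)"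
| "coefficients t351 x = triangle_coefficients x"
| "coefficients t352 x = triangle_coefficients x"

lemma region_labelling_of:
  assumes "x = labelling_of t k"
  shows "region t x"
  using assms by (cases t; simp only: labelling_of_iff region.simps triangles_def) auto

lemma coefficients_labelling_of:
  assumes "x = labelling_of t k"
  shows "coefficients t x = k"
  using assms
  by (cases t; simp only: labelling_of_iff coefficients.simps triangle_coefficients_def
      vec_6_eq_iff vec_6_nth) auto

text \<open>With \<open>r\<close> eliminated, the labels 3, 5, 12 and 4, 6, 10 serve as coordinates:
  the first two identities yield the labels 1 and 2, the last four the labels 7, 8, 9 and
  11.\<close>

lemma magic_with_sum_identities:
  assumes "magic_with_sum x r"
  shows "x $ 4 + x $ 5 + x $ 6 + x $ 12 = 2 * (x $ 1) + x $ 3 + x $ 10"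
    and "x $ 3 + x $ 5 + x $ 6 + x $ 10 = 2 * (x $ 2) + x $ 4 + x $ 12"
    and "x $ 1 + x $ 2 = x $ 5 + x $ 6"
    and "x $ 1 + x $ 3 = x $ 5 + x $ 7"
    and "x $ 1 + x $ 8 = x $ 4 + x $ 5"
    and "x $ 2 + x $ 9 = x $ 3 + x $ 10"
    and "x $ 2 + x $ 12 = x $ 3 + x $ 11"
  using assms unfolding magic_with_sum_def by linarith+

text \<open>Two failures of different kinds contradict each other directly when they concern the
  same triple of labels. In different triples, the identities would make one of the labels 1, 2, 7,
  8, 9, 11 negative.\<close>

lemma region_disjoint:
  assumes "magic_with_sum x r" "region t x" "region t' x"
  shows "t = t'"
  using magic_with_sum_identities[OF assms(1)] assms(2,3)
  by (cases t; cases t'; simp add: triangles_def)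

text \<open>Each inequality on 3, 5, 12 is paired with one on 4, 6, 10: by the first two identities,
  their excesses (larger side minus the sum) differ by twice a difference of two labels. The label
  comparison in a region selects the larger excess, so if both regions of a pair are avoided, both
  inequalities hold.\<close>

lemma ex_region:
  assumes "magic_with_sum x r"
  shows "\<exists>t. region t x"
proof (rule ccontr)
  assume "\<nexists>t. region t x"
  then have no_region: "\<not> region t x" for t
    by blast
  note identities = magic_with_sum_identities[OF assms]
  have "x $ 12 \<le> x $ 3 + x $ 5" "x $ 10 \<le> x $ 4 + x $ 6"
    using no_region[of t31] no_region[of t32] identities(1) by auto
  moreover have "x $ 3 \<le> x $ 5 + x $ 12" "x $ 6 \<le> x $ 4 + x $ 10"
    using no_region[of t33] no_region[of t34] identities(1) by auto
  moreover have "x $ 5 < x $ 3 + x $ 12" "x $ 4 < x $ 6 + x $ 10"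
    using no_region[of t1] no_region[of t2] identities(2) by auto
  ultimately have "triangles x"
    by (simp add: triangles_def)
  then show False
    using no_region[of t351] no_region[of t352] by auto
qed

text \<open>\<open>p\<close> and \<open>q\<close> are the two sides of a triangle inequality, and
  \<open>p - q\<close> has the parity of \<open>p + q\<close>. In the strict version the difference
  is twice the quotient plus 2 minus the parity; the parity is moved to the left to avoid
  subtraction.\<close>

lemma div_2_diff:
  fixes p q :: nat
  shows "q \<le> p \<Longrightarrow> p = q + 2 * ((p - q) div 2) + (p + q) mod 2"
    and "q < p \<Longrightarrow> p + (p + q) mod 2 = q + 2 * ((p - q - 1) div 2) + 2"
proof -
  assume "q \<le> p"
  then obtain y where "p = q + y"
    using le_Suc_ex by blast
  then show "p = q + 2 * ((p - q) div 2) + (p + q) mod 2"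
    by simp presburger
next
  assume "q < p"
  then obtain y where "p = q + 1 + y"
    using less_natE by auto
  then show "p + (p + q) mod 2 = q + 2 * ((p - q - 1) div 2) + 2"
    by simp presburger
qed

lemma labelling_of_coefficients:
  assumes "magic_with_sum x r" "region t x"
  shows "x = labelling_of t (coefficients t x)"
proof -
  note magic = assms(1)[unfolded magic_with_sum_def]
  show ?thesis
  proof (cases "t = t351 \<or> t = t352")
    case False
    with magic assms(2) show ?thesis
      by (cases t; simp only: labelling_of_iff coefficients.simps vec_6_nth region.simps; auto)
  next
    case True
    \<comment> \<open>Since \<open>T\<close> is the sum of \<open>\<alpha>\<^sub>4\<close>,
      \<open>\<alpha>\<^sub>7\<close> and \<open>\<alpha>\<^sub>5\<close>, the offset of either type
      is \<open>\<alpha>\<^sub>4 + \<alpha>\<^sub>7\<close> plus \<open>d\<close> times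
      \<open>\<alpha>\<^sub>5\<close>. Hence \<open>d\<close> occurs below exactly in the labels 1,
      4, 5 and 8.\<close>
    define d where "d = (x $ 3 + x $ 5 + x $ 12) mod 2"
    define k where "k = triangle_coefficients x"
    from True assms(2) have "triangles x"
      by auto
    \<comment> \<open>The total is even, so both triples have the same parity and a single
      \<open>d\<close> serves both.\<close>
    have "(x $ 4 + x $ 6 + x $ 10) + (x $ 3 + x $ 5 + x $ 12) = 2 * (x $ 1 + x $ 3 + x $ 10)"
      using magic_with_sum_identities(1)[OF assms(1)] by simp
    then have d: "(x $ 4 + x $ 6 + x $ 10) mod 2 = d"
      unfolding d_def by (metis dvd_triv_left even_add parity_cases)
    have halves: "x $ 3 + x $ 5 = x $ 12 + 2 * k $ 1 + d"
      "x $ 5 + x $ 12 = x $ 3 + 2 * k $ 3 + d"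
      "x $ 3 + x $ 12 + d = x $ 5 + 2 * k $ 6 + 2"
      using \<open>triangles x\<close> div_2_diff(1)[of "x $ 12" "x $ 3 + x $ 5"]
        div_2_diff(1)[of "x $ 3" "x $ 5 + x $ 12"] div_2_diff(2)[of "x $ 5" "x $ 3 + x $ 12"]
      by (simp_all add: triangles_def d_def k_def triangle_coefficients_def ac_simps)
    have halves': "x $ 4 + x $ 6 = x $ 10 + 2 * k $ 2 + d"
      "x $ 4 + x $ 10 = x $ 6 + 2 * k $ 5 + d"
      "x $ 6 + x $ 10 + d = x $ 4 + 2 * k $ 4 + 2"
      using \<open>triangles x\<close> div_2_diff(1)[of "x $ 10" "x $ 4 + x $ 6"]
        div_2_diff(1)[of "x $ 6" "x $ 4 + x $ 10"] div_2_diff(2)[of "x $ 4" "x $ 6 + x $ 10"]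
      by (simp_all add: triangles_def flip: d) (simp_all add: k_def triangle_coefficients_def ac_simps)
    \<comment> \<open>Adding two equations of one triple gives twice a label.\<close>
    have outer: "x $ 3 = k $ 1 + k $ 6 + 1" "x $ 5 = k $ 1 + k $ 3 + d"
      "x $ 12 = k $ 3 + k $ 6 + 1" "x $ 4 = k $ 2 + k $ 5 + d"
      "x $ 6 = k $ 2 + k $ 4 + 1" "x $ 10 = k $ 4 + k $ 5 + 1"
      using halves halves' by linarith+
    have inner: "x $ 1 = k $ 2 + k $ 3 + d" "x $ 2 = k $ 1 + k $ 4 + 1"
      using outer magic_with_sum_identities[OF assms(1)] by linarith+
    have rest: "x $ 7 = k $ 2 + k $ 6 + 1" "x $ 8 = k $ 1 + k $ 5 + d"
      "x $ 9 = k $ 5 + k $ 6 + 1" "x $ 11 = k $ 3 + k $ 4 + 1"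
      using outer inner magic by linarith+
    have "even (x $ 3 + x $ 5 + x $ 12) \<longleftrightarrow> t = t351"
      using True assms(2) by (elim disjE) (simp_all del: even_add)
    then have "d = (if t = t351 then 0 else 1)"
      by (simp only: d_def mod2_eq_if)
    with True have "x = labelling_of t k"
      using outer inner rest
      by (elim disjE) (simp_all add: labelling_of_iff del: labelling_of.simps)
    with True show ?thesis
      by (auto simp: k_def)
  qed
qed

theorem theorem1p1:
  fixes \<alpha> :: "nat ^ 12"
  assumes "\<alpha> \<in> magic_labellings"
  shows "\<exists>!p :: labelling_type \<times> (nat ^ 6). case p of (t, k) \<Rightarrow> \<alpha> = labelling_of t k"
proof -
  from assms obtain r where magic: "magic_with_sum \<alpha> r"
    by (auto simp: magic_labellings_def)
  then obtain t where region: "region t \<alpha>"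
    using ex_region by blast
  show ?thesis
  proof (rule ex1I)
    show "case (t, coefficients t \<alpha>) of (t, k) \<Rightarrow> \<alpha> = labelling_of t k"
      using labelling_of_coefficients[OF magic region] by simp
  next
    fix p
    assume "case p of (t', k) \<Rightarrow> \<alpha> = labelling_of t' k"
    then obtain t' k where p: "p = (t', k)" and eq: "\<alpha> = labelling_of t' k"
      by (cases p) auto
    with region_disjoint[OF magic region region_labelling_of[OF eq]] coefficients_labelling_of[OF eq]
    show "p = (t, coefficients t \<alpha>)"
      by simp
  qed
qed

end
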